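(* Let $c\in\mathbb R$, $p>1$, and let $f(x)=(x-c)^p g(x)$, where $g:\mathbb R\to\mathbb R$ is a $C^2$ function for which both $g'(x)/g(x)$ and $g''(x)/g(x)$ are bounded in an open interval $\mathcal N$ containing $c$ (with $g$ having no zero in $\mathcal N$). Write $e(x)=c-x$, let $$M_0=\sup_{x\in\mathcal N}\frac1p\left|\left(\frac{g'(x)}{g(x)}\right)^2-\frac{g''(x)}{g(x)}\right|,\qquad M_1=\sup_{x\in\mathcal N}\frac1p\left|\frac{g'(x)}{g(x)}\right|,$$ $$\mathcal N_0=\{x\in\mathcal N:\ e(x)^2<M_0^{-1}\ \text{ and }\ |e(x)|<M_1^{-1}\},\qquad \mathcal N_1=\{x\in\mathcal N_0:\ |e(x)|<1/(2M_1)\}.$$ Then there exists an open interval $\mathcal N_\ast\subseteq\mathcal N_1$ containing $c$ such that, if two consecutive iterates $x_{k-1},x_k$ ($k\ge1$) of the Newton-Anderson rootfinding method for $f$ lie in $\mathcal N_\ast$, then all subsequent iterates remain in $\mathcal N_\ast$ and the iterates converge superlinearly to the root $c$.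
   Context: Newton-Anderson rootfinding method for $f:\mathbb R\to\mathbb R$: choose $x_0$, compute $w_1=-f(x_0)/f'(x_0)$ and set $x_1=x_0+w_1$. For $k=1,2,\ldots$ compute $w_{k+1}=-f(x_k)/f'(x_k)$ and set $$x_{k+1}=x_k-\frac{x_k-x_{k-1}}{w_{k+1}-w_k}\,w_{k+1}.$$ Conventions: $M_0^{-1}$, $M_1^{-1}$ and $1/(2M_1)$ are read as $+\infty$ when the corresponding constant is $0$. The number $p$ is the multiplicity of the root $c$ of $f$, and $(x-c)^p$ is understood to be a well-defined real-valued power for all real $x$ (for instance, $p$ an integer). The iterates $x_{k-1},x_k$ are understood to be distinct from each other and from $c$, so that the update is meaningful; if some later iterate equals $c$ exactly, the iteration stops there, having found the root. Superlinear convergence to $c$ means $x_j\to c$ and $|x_{j+1}-c|/|x_j-c|\to0$ as $j\to\infty$ (when the iteration does not stop at $c$ after finitely many steps). *)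

theory Defs
  imports "HOL-Analysis.Analysis"
begin

text \<open>
  A function \<open>pw\<close> is a real-valued \<open>p\<close>-th power on the whole real line if it is the usual power
  on the nonnegative half-line and is multiplicative. The latter leaves, for negative arguments, only
  \<open>pw (- t) = pw (- 1) * t powr p\<close> with \<open>pw (- 1)\<close> equal to \<open>1\<close> or \<open>- 1\<close>. The two lemmas below
  give the standard instances. (The library's \<open>powr\<close> alone will not do: it is meant for
  nonnegative bases only.)
\<close>

definition real_power :: "real \<Rightarrow> (real \<Rightarrow> real) \<Rightarrow> bool" where
  "real_power p pw \<longleftrightarrow>
     (\<forall>t\<ge>0. pw t = t powr p) \<and> (\<forall>s t. pw (s * t) = pw s * pw t)"

lemma real_power_nat: "n > 0 \<Longrightarrow> real_power (real n) (\<lambda>t. t ^ n)"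
  by (auto simp: real_power_def powr_realpow' power_mult_distrib)

lemma real_power_odd_root:
  assumes "odd n" "m > 0"
  shows "real_power (real m / real n) (\<lambda>t. root n t ^ m)"
proof -
  have n: "n > 0" using assms(1) by (rule odd_pos)
  have "root n t ^ m = t powr (real m / real n)" if "t \<ge> 0" for t :: real
  proof (cases "t = 0")
    case True
    then show ?thesis using n assms(2) by simp
  next
    case False
    then have "t > 0" using that by simp
    then have "root n t ^ m = (t powr (1 / real n)) powr real m"
      using n by (simp add: root_powr_inverse powr_realpow)
    then show ?thesis by (simp add: powr_powr)
  qed
  then show ?thesis
    by (simp add: real_power_def real_root_mult power_mult_distrib)
qed

definition C2 :: "(real \<Rightarrow> real) \<Rightarrow> bool" where
  "C2 g \<longleftrightarrow> (\<forall>x. g differentiable (at x)) \<and> (\<forall>x. deriv g differentiable (at x)) \<and>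
     continuous_on UNIV (deriv (deriv g))"

definition open_interval :: "real set \<Rightarrow> bool" where
  "open_interval S \<longleftrightarrow> open S \<and> is_interval S"

definition M0 :: "real \<Rightarrow> (real \<Rightarrow> real) \<Rightarrow> real set \<Rightarrow> real" where
  "M0 p g N = (SUP x\<in>N. 1 / p * \<bar>(deriv g x / g x)\<^sup>2 - deriv (deriv g) x / g x\<bar>)"

definition M1 :: "real \<Rightarrow> (real \<Rightarrow> real) \<Rightarrow> real set \<Rightarrow> real" where
  "M1 p g N = (SUP x\<in>N. 1 / p * \<bar>deriv g x / g x\<bar>)"

text \<open>
  The reciprocal bounds are read as infinite when the constant is \<open>0\<close>, hence the disjunctions
  (division by \<open>0\<close> yields \<open>0\<close> in HOL).
\<close>

definition N0 :: "real \<Rightarrow> real \<Rightarrow> (real \<Rightarrow> real) \<Rightarrow> real set \<Rightarrow> real set" where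
  "N0 c p g N = {x \<in> N. (M0 p g N = 0 \<or> (c - x)\<^sup>2 < 1 / M0 p g N) \<and>
                        (M1 p g N = 0 \<or> \<bar>c - x\<bar> < 1 / M1 p g N)}"

definition N1 :: "real \<Rightarrow> real \<Rightarrow> (real \<Rightarrow> real) \<Rightarrow> real set \<Rightarrow> real set" where
  "N1 c p g N = {x \<in> N0 c p g N. M1 p g N = 0 \<or> \<bar>c - x\<bar> < 1 / (2 * M1 p g N)}"

definition newton_update :: "(real \<Rightarrow> real) \<Rightarrow> real \<Rightarrow> real" where
  "newton_update f y = - f y / deriv f y"

text \<open>
  \<open>newton_anderson f c x\<close>: the sequence \<open>x\<close> is produced by the method. With
  \<open>w\<^sub>k\<^sub>+\<^sub>1 = newton_update f (x k)\<close>, the last clause is the update for the index \<open>Suc k\<close>.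
  A run that reaches the root \<open>c\<close> stops there; this is represented by continuing it with the
  constant value \<open>c\<close>.
\<close>

definition newton_anderson :: "(real \<Rightarrow> real) \<Rightarrow> real \<Rightarrow> (nat \<Rightarrow> real) \<Rightarrow> bool" where
  "newton_anderson f c x \<longleftrightarrow>
     (\<forall>k. x k = c \<longrightarrow> x (Suc k) = c) \<and>
     (x 0 \<noteq> c \<longrightarrow> x 1 = x 0 + newton_update f (x 0)) \<and>
     (\<forall>k. x (Suc k) \<noteq> c \<longrightarrow>
        x (Suc (Suc k)) = x (Suc k) -
          (x (Suc k) - x k) / (newton_update f (x (Suc k)) - newton_update f (x k))
            * newton_update f (x (Suc k)))"

text \<open>
  The quotients occurring in the update from \<open>x (k - 1)\<close> and \<open>x k\<close> (for \<open>k \<ge> 1\<close>) have nonzero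
  denominators, so that the update is not an artefact of division by \<open>0\<close> being total in HOL.
\<close>

definition update_defined :: "(real \<Rightarrow> real) \<Rightarrow> (nat \<Rightarrow> real) \<Rightarrow> nat \<Rightarrow> bool" where
  "update_defined f x k \<longleftrightarrow> deriv f (x (k - 1)) \<noteq> 0 \<and> deriv f (x k) \<noteq> 0 \<and>
     newton_update f (x k) \<noteq> newton_update f (x (k - 1))"

definition converges_superlinearly :: "(nat \<Rightarrow> real) \<Rightarrow> real \<Rightarrow> bool" where
  "converges_superlinearly x c \<longleftrightarrow> x \<longlonglongrightarrow> c \<and>
     ((\<forall>j. x j \<noteq> c) \<longrightarrow> (\<lambda>j. \<bar>x (Suc j) - c\<bar> / \<bar>x j - c\<bar>) \<longlonglongrightarrow> 0)"

end

theory Submission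
  imports Defs
begin

text \<open>
  Put \<open>u = x - c\<close> and \<open>h = g' / g\<close>. Near \<open>c\<close> the Newton update is \<open>w x = - u / (p + u * h x)\<close>,
  which vanishes at \<open>c\<close> and has slope \<open>- 1 / p\<close> there, so a multiple root of \<open>f\<close> has become a
  simple zero of \<open>w\<close>. The Newton-Anderson step is the secant step for \<open>w\<close>. The divided
  differences of \<open>w\<close> differ from \<open>- 1 / p\<close> by at most a constant times the distance to \<open>c\<close>, and
  therefore each secant step multiplies the error by a factor of the size of the two previous
  errors.
\<close>

section \<open>Real-valued powers and the Newton update at a multiple root\<close>

lemma real_power_nonzero:
  assumes "real_power p pw" "t \<noteq> 0"
  shows "pw t \<noteq> 0"
proof -
  have "pw t * pw (1 / t) = pw 1"
    using assms unfolding real_power_def by (metis nonzero_mult_div_cancel_left times_divide_eq_right mult_1_right)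
  moreover have "pw 1 = 1"
    using assms(1) by (simp add: real_power_def)
  ultimately show ?thesis by auto
qed

lemma real_power_0: "real_power p pw \<Longrightarrow> pw 0 = 0"
  by (simp add: real_power_def)

text \<open>On the negative half-line multiplicativity gives
  \<open>pw s = pw (- 1) * (- s) powr p\<close>, and the sign factor is constant. Writing the
  derivative as \<open>p * pw t / t\<close> covers both half-lines at once and is ready for the
  logarithmic derivative of \<open>f\<close>.\<close>

lemma real_power_has_derivative:
  assumes pw: "real_power p pw" and t: "t \<noteq> 0"
  shows "(pw has_real_derivative p * pw t / t) (at t)"
proof (cases "t > 0")
  case True
  have "((\<lambda>s. s powr p) has_real_derivative p * t powr (p - 1)) (at t)"
    using has_real_derivative_powr[OF True] .
  moreover have "p * t powr (p - 1) = p * pw t / t"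
    using True pw by (simp add: real_power_def powr_diff)
  ultimately have "((\<lambda>s. s powr p) has_real_derivative p * pw t / t) (at t)"
    by simp
  then show ?thesis
    by (rule has_field_derivative_transform_within_open[where S = "{0<..}"])
      (use True pw in \<open>auto simp: real_power_def\<close>)
next
  case False
  then have neg: "t < 0" using t by simp
  have eq: "pw s = pw (- 1) * (- s) powr p" if "s < 0" for s
  proof -
    have "pw (- 1 * - s) = pw (- 1) * pw (- s)"
      using pw unfolding real_power_def by blast
    then show ?thesis using that pw by (simp add: real_power_def)
  qed
  have "((\<lambda>s. pw (- 1) * (- s) powr p) has_real_derivative
      pw (- 1) * (p * (- t) powr (p - 1) * (- 1))) (at t)"
    using neg by (intro DERIV_cmult DERIV_chain'[where f = uminus] has_real_derivative_powr)
      (auto intro!: derivative_eq_intros)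
  moreover have "pw (- 1) * (p * (- t) powr (p - 1) * (- 1)) = p * pw t / t"
    using neg by (simp add: eq[OF neg] powr_diff)
  ultimately have "((\<lambda>s. pw (- 1) * (- s) powr p) has_real_derivative p * pw t / t) (at t)"
    by simp
  then show ?thesis
    by (rule has_field_derivative_transform_within_open[where S = "{..<0}"])
      (use neg in \<open>simp_all add: eq[symmetric]\<close>)
qed

text \<open>The logarithmic derivative of \<open>f\<close> is \<open>p / (x - c) + g' / g\<close>,
  and the Newton update is minus its reciprocal. Multiplying through by \<open>x - c\<close> removes
  the singularity, so the formula for the update also makes sense at \<open>c\<close>.\<close>

lemma newton_update_multiple_root:
  assumes pw: "real_power p pw" and f: "\<And>x. f x = pw (x - c) * g x"
    and g: "g differentiable (at x)" "g x \<noteq> 0"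
    and q: "p + (x - c) * (deriv g x / g x) \<noteq> 0"
  shows "newton_update f x = (x - c) * (- 1 / (p + (x - c) * (deriv g x / g x)))"
    and "x \<noteq> c \<Longrightarrow> deriv f x \<noteq> 0"
proof -
  have main: "deriv f x \<noteq> 0 \<and>
      newton_update f x = (x - c) * (- 1 / (p + (x - c) * (deriv g x / g x)))" if x: "x \<noteq> c"
  proof -
    have g': "(g has_real_derivative deriv g x) (at x)"
      using g(1) by (metis DERIV_deriv_iff_real_differentiable)
    have "((\<lambda>y. pw (y - c)) has_real_derivative p * pw (x - c) / (x - c) * 1) (at x)"
      using x by (intro DERIV_chain'[where f = "\<lambda>y. y - c"] real_power_has_derivative[OF pw])
        (auto intro!: derivative_eq_intros)
    from DERIV_mult[OF this g']
    have "(f has_real_derivative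
        p * pw (x - c) / (x - c) * g x + deriv g x * pw (x - c)) (at x)"
      by (simp add: f[abs_def] mult.commute)
    moreover have "p * pw (x - c) / (x - c) * g x + deriv g x * pw (x - c) =
        f x * (p + (x - c) * (deriv g x / g x)) / (x - c)"
      using x g(2) by (simp add: f divide_simps) (simp add: algebra_simps)
    ultimately have f': "deriv f x = f x * (p + (x - c) * (deriv g x / g x)) / (x - c)"
      by (metis DERIV_imp_deriv)
    have "f x \<noteq> 0"
      using real_power_nonzero[OF pw] x g(2) by (simp add: f)
    then show ?thesis
      using x q by (simp add: newton_update_def f')
  qed
  \<comment> \<open>At \<open>c\<close> both sides are 0: the numerator \<open>f c\<close> vanishes,
    so the quotient is 0 in HOL whatever \<open>deriv f c\<close> is.\<close>
  show "newton_update f x = (x - c) * (- 1 / (p + (x - c) * (deriv g x / g x)))"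
    using main real_power_0[OF pw] by (cases "x = c") (simp_all add: newton_update_def f)
  show "x \<noteq> c \<Longrightarrow> deriv f x \<noteq> 0" using main by blast
qed

section \<open>Estimates for divided differences\<close>

text \<open>The increment is split so that every term keeps a factor \<open>x - y\<close>. After
  division by \<open>x - y\<close>, the divided difference of \<open>(x - c) * k x\<close> is
  therefore \<open>k c\<close> up to an error linear in the distances to \<open>c\<close>.\<close>

lemma linear_factor_times_lipschitz:
  fixes k :: "real \<Rightarrow> real"
  assumes k: "\<And>x y. x \<in> S \<Longrightarrow> y \<in> S \<Longrightarrow> \<bar>k x - k y\<bar> \<le> L * \<bar>x - y\<bar>"
    and "c \<in> S" "x \<in> S" "y \<in> S"
  shows "\<bar>(x - c) * k x - (y - c) * k y - k c * (x - y)\<bar>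
           \<le> L * (\<bar>x - c\<bar> + \<bar>y - c\<bar>) * \<bar>x - y\<bar>"
proof -
  have "(x - c) * k x - (y - c) * k y - k c * (x - y) =
      (x - y) * (k x - k c) + (y - c) * (k x - k y)"
    by (simp add: algebra_simps)
  also have "\<bar>\<dots>\<bar> \<le> \<bar>x - y\<bar> * \<bar>k x - k c\<bar> + \<bar>y - c\<bar> * \<bar>k x - k y\<bar>"
    by (metis abs_mult abs_triangle_ineq)
  also have "\<dots> \<le> \<bar>x - y\<bar> * (L * \<bar>x - c\<bar>) + \<bar>y - c\<bar> * (L * \<bar>x - y\<bar>)"
    using assms by (intro add_mono mult_left_mono k) auto
  finally show ?thesis by (simp add: algebra_simps)
qed

text \<open>Serves to pass from the denominator \<open>q\<close> of the Newton update to the factor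
  \<open>k = - 1 / q\<close> of the preceding lemma.\<close>

lemma reciprocal_lipschitz:
  fixes q :: "real \<Rightarrow> real"
  assumes q: "\<And>x y. x \<in> S \<Longrightarrow> y \<in> S \<Longrightarrow> \<bar>q x - q y\<bar> \<le> Q * \<bar>x - y\<bar>"
    and m: "m > 0" "\<And>x. x \<in> S \<Longrightarrow> m \<le> q x"
    and S: "x \<in> S" "y \<in> S"
  shows "\<bar>- 1 / q x - (- 1 / q y)\<bar> \<le> Q / m\<^sup>2 * \<bar>x - y\<bar>"
proof -
  have pos: "q x > 0" "q y > 0" using m S by (force intro: less_le_trans)+
  have "m\<^sup>2 \<le> q x * q y"
    using m S by (auto simp: power2_eq_square intro!: mult_mono less_imp_le[OF pos(1)])
  have "\<bar>- 1 / q x - (- 1 / q y)\<bar> = \<bar>q x - q y\<bar> / (q x * q y)"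
    using pos by (simp add: abs_if field_simps)
  also have "\<dots> \<le> \<bar>q x - q y\<bar> / m\<^sup>2"
    using \<open>m\<^sup>2 \<le> q x * q y\<close> m(1) by (intro divide_left_mono mult_pos_pos) (auto simp: pos)
  also have "\<dots> \<le> Q * \<bar>x - y\<bar> / m\<^sup>2"
    using q[OF S] by (rule divide_right_mono) simp
  finally show ?thesis by simp
qed

section \<open>The secant method near a simple zero\<close>

text \<open>The secant slope \<open>s\<close> is close to \<open>a\<close>, and so is the slope of
  the chord from \<open>c\<close> to \<open>y\<close>; the new error is the old one times their
  difference divided by \<open>s\<close>. The four conclusions serve, in order, well-definedness,
  superlinear convergence, invariance of the ball, and distinctness of the next pair.\<close>

lemma secant_step:
  fixes w :: "real \<Rightarrow> real"
  assumes w: "\<And>x y. x \<in> ball c d \<Longrightarrow> y \<in> ball c d \<Longrightarrow>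
      \<bar>w x - w y - a * (x - y)\<bar> \<le> L * (\<bar>x - c\<bar> + \<bar>y - c\<bar>) * \<bar>x - y\<bar>"
    and "w c = 0" "a \<noteq> 0" "L \<ge> 0" and d: "12 * L * d \<le> \<bar>a\<bar>"
    and xy: "x \<in> ball c d" "y \<in> ball c d" "x \<noteq> y"
  defines "z \<equiv> y - (y - x) / (w y - w x) * w y"
  shows "w y \<noteq> w x"
    and "\<bar>z - c\<bar> \<le> \<bar>y - c\<bar> * (2 * L / \<bar>a\<bar> * (2 * \<bar>y - c\<bar> + \<bar>x - c\<bar>))"
    and "\<bar>z - c\<bar> \<le> \<bar>y - c\<bar> / 2"
    and "y \<noteq> c \<Longrightarrow> z \<noteq> y"
proof -
  define s where "s = (w y - w x) / (y - x)"
  have dist: "\<bar>x - c\<bar> < d" "\<bar>y - c\<bar> < d"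
    using xy by (auto simp: dist_real_def)
  have small: "L * (\<bar>u\<bar> + \<bar>v\<bar>) \<le> \<bar>a\<bar> / 6" if "\<bar>u\<bar> < d" "\<bar>v\<bar> < d" for u v
  proof -
    have "L * (\<bar>u\<bar> + \<bar>v\<bar>) \<le> L * (d + d)"
      using that \<open>L \<ge> 0\<close> by (intro mult_left_mono) auto
    then show ?thesis using d by simp
  qed
  have s: "\<bar>s - a\<bar> \<le> L * (\<bar>y - c\<bar> + \<bar>x - c\<bar>)"
  proof -
    have "s - a = (w y - w x - a * (y - x)) / (y - x)"
      using xy(3) by (simp add: s_def diff_divide_distrib)
    then have "\<bar>s - a\<bar> = \<bar>w y - w x - a * (y - x)\<bar> / \<bar>y - x\<bar>"
      by (simp add: abs_divide)
    then show ?thesis using w[OF xy(2,1)] xy(3) by (simp add: pos_divide_le_eq)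
  qed
  \<comment> \<open>The slope differs from \<open>a\<close> by at most
    \<open>\<bar>a\<bar> / 6\<close>.\<close>
  have s_lower: "\<bar>s\<bar> \<ge> \<bar>a\<bar> / 2"
    using s small[OF dist(2,1)] by linarith
  then have "s \<noteq> 0" using \<open>a \<noteq> 0\<close> by auto
  then show "w y \<noteq> w x" by (auto simp: s_def)
  have "c \<in> ball c d" using dist by simp
  have wy: "\<bar>w y - a * (y - c)\<bar> \<le> L * \<bar>y - c\<bar> * \<bar>y - c\<bar>"
    using w[OF xy(2) \<open>c \<in> ball c d\<close>] \<open>w c = 0\<close> by simp
  have z: "z = y - w y / s"
    by (simp add: z_def s_def)
  \<comment> \<open>Adding and subtracting \<open>a * (y - c)\<close> in
    \<open>s * (y - c) - w y\<close> leaves two differences, each of second order in the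
    errors.\<close>
  have "z - c = ((s - a) * (y - c) - (w y - a * (y - c))) / s"
    using \<open>s \<noteq> 0\<close> by (simp add: z field_simps)
  then have "\<bar>z - c\<bar> = \<bar>(s - a) * (y - c) - (w y - a * (y - c))\<bar> / \<bar>s\<bar>"
    by (simp add: abs_divide)
  also have "\<dots> \<le> (L * (\<bar>y - c\<bar> + \<bar>x - c\<bar>) * \<bar>y - c\<bar> + L * \<bar>y - c\<bar> * \<bar>y - c\<bar>) / \<bar>s\<bar>"
  proof (intro divide_right_mono)
    have "\<bar>(s - a) * (y - c)\<bar> \<le> L * (\<bar>y - c\<bar> + \<bar>x - c\<bar>) * \<bar>y - c\<bar>"
      unfolding abs_mult using s by (intro mult_right_mono) auto
    then show "\<bar>(s - a) * (y - c) - (w y - a * (y - c))\<bar>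
        \<le> L * (\<bar>y - c\<bar> + \<bar>x - c\<bar>) * \<bar>y - c\<bar> + L * \<bar>y - c\<bar> * \<bar>y - c\<bar>"
      using wy by linarith
  qed simp
  also have "\<dots> \<le> (L * (\<bar>y - c\<bar> + \<bar>x - c\<bar>) * \<bar>y - c\<bar> + L * \<bar>y - c\<bar> * \<bar>y - c\<bar>) / (\<bar>a\<bar> / 2)"
    using s_lower \<open>a \<noteq> 0\<close> \<open>L \<ge> 0\<close> \<open>s \<noteq> 0\<close> by (intro divide_left_mono) auto
  also have "\<dots> = \<bar>y - c\<bar> * (2 * L / \<bar>a\<bar> * (2 * \<bar>y - c\<bar> + \<bar>x - c\<bar>))"
  proof -
    have "(L * (u + v) * u + L * u * u) / (\<bar>a\<bar> / 2) = u * (2 * L / \<bar>a\<bar> * (2 * u + v))"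
      for u v :: real
      by (simp add: algebra_simps add_divide_distrib)
    then show ?thesis .
  qed
  finally show bound: "\<bar>z - c\<bar> \<le> \<bar>y - c\<bar> * (2 * L / \<bar>a\<bar> * (2 * \<bar>y - c\<bar> + \<bar>x - c\<bar>))" .
  \<comment> \<open>This step fixes the constant 12: the contraction factor is at most
    \<open>2 * L / \<bar>a\<bar> * (3 * d)\<close>, which is at most 1/2 exactly when
    \<open>12 * L * d \<le> \<bar>a\<bar>\<close>.\<close>
  have "L * (2 * \<bar>y - c\<bar> + \<bar>x - c\<bar>) \<le> L * (3 * d)"
    using dist \<open>L \<ge> 0\<close> by (intro mult_left_mono) auto
  then have "2 * L / \<bar>a\<bar> * (2 * \<bar>y - c\<bar> + \<bar>x - c\<bar>) \<le> 1 / 2"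
    using d \<open>a \<noteq> 0\<close> by (simp add: pos_divide_le_eq)
  from mult_left_mono[OF this abs_ge_zero[of "y - c"]] bound
  show "\<bar>z - c\<bar> \<le> \<bar>y - c\<bar> / 2" by simp
  show "z \<noteq> y" if "y \<noteq> c"
  proof
    assume "z = y"
    then show False using \<open>\<bar>z - c\<bar> \<le> \<bar>y - c\<bar> / 2\<close> that by simp
  qed
qed

text \<open>Halving of the error keeps the iterates in the ball and forces convergence; the sharper
  bound of \<open>secant_step\<close> then makes the error ratio at most a constant times the two
  previous errors, which now tend to 0.\<close>

lemma secant_converges:
  fixes w :: "real \<Rightarrow> real" and z :: "nat \<Rightarrow> real"
  assumes w: "\<And>x y. x \<in> ball c d \<Longrightarrow> y \<in> ball c d \<Longrightarrow>
      \<bar>w x - w y - a * (x - y)\<bar> \<le> L * (\<bar>x - c\<bar> + \<bar>y - c\<bar>) * \<bar>x - y\<bar>"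
    and a: "w c = 0" "a \<noteq> 0" "L \<ge> 0" "12 * L * d \<le> \<bar>a\<bar>"
    and start: "z 0 \<in> ball c d" "z 1 \<in> ball c d" "z 0 \<noteq> z 1"
    and stop: "\<And>n. z n = c \<Longrightarrow> z (Suc n) = c"
    and step: "\<And>n. z (Suc n) \<noteq> c \<Longrightarrow> z (Suc (Suc n)) =
        z (Suc n) - (z (Suc n) - z n) / (w (z (Suc n)) - w (z n)) * w (z (Suc n))"
  shows "z n \<in> ball c d"
    and "z (Suc n) \<noteq> c \<Longrightarrow> w (z (Suc n)) \<noteq> w (z n)"
    and "converges_superlinearly z c"
proof -
  note secant = secant_step[where w = w and c = c and d = d and a = a and L = L, OF w a]
  \<comment> \<open>Distinctness of consecutive iterates has to be carried along, since the secant
    slope requires it. It is conditional because a stopped run is constant.\<close>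
  have inv: "z n \<in> ball c d \<and> z (Suc n) \<in> ball c d \<and> (z (Suc n) \<noteq> c \<longrightarrow> z n \<noteq> z (Suc n))" for n
  proof (induction n)
    case 0
    then show ?case using start by simp
  next
    case (Suc n)
    show ?case
    proof (cases "z (Suc n) = c")
      case True
      then show ?thesis using Suc stop by simp
    next
      case False
      then have ne: "z n \<noteq> z (Suc n)" using Suc by blast
      have "\<bar>z (Suc (Suc n)) - c\<bar> \<le> \<bar>z (Suc n) - c\<bar> / 2"
        unfolding step[OF False] using Suc ne by (intro secant(3)) auto
      also have "\<dots> \<le> \<bar>z (Suc n) - c\<bar>" by simp
      also have "\<dots> < d"
        using Suc by (auto simp: dist_real_def abs_minus_commute[of c])
      finally have "\<bar>z (Suc (Suc n)) - c\<bar> < d" .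
      then have "z (Suc (Suc n)) \<in> ball c d"
        by (simp add: dist_real_def abs_minus_commute[of c])
      moreover have "z (Suc (Suc n)) \<noteq> z (Suc n)"
        unfolding step[OF False] using Suc ne False by (intro secant(4)) auto
      ultimately show ?thesis using Suc by simp
    qed
  qed
  show "z n \<in> ball c d" using inv by blast
  show "w (z (Suc n)) \<noteq> w (z n)" if "z (Suc n) \<noteq> c"
    using inv[of n] that by (intro secant(1)) auto
  have half: "\<bar>z (Suc (Suc n)) - c\<bar> \<le> 1 / 2 * \<bar>z (Suc n) - c\<bar>" for n
  proof (cases "z (Suc n) = c")
    case True
    then show ?thesis using stop by simp
  next
    case False
    show ?thesis
      unfolding step[OF False] using inv[of n] False
      by (intro order_trans[OF secant(3)]) auto
  qed
  \<comment> \<open>The geometric decay starts at \<open>z 1\<close>: the pair \<open>z 0\<close>,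
    \<open>z 1\<close> is given, and nothing compares their errors.\<close>
  have geo: "\<bar>z (Suc n) - c\<bar> \<le> (1 / 2) ^ n * \<bar>z 1 - c\<bar>" for n
  proof (induction n)
    case (Suc n)
    then show ?case using half[of n] by simp
  qed simp
  have "(\<lambda>n. (1 / 2) ^ n * \<bar>z 1 - c\<bar>) \<longlonglongrightarrow> 0"
    by (intro tendsto_mult_left_zero LIMSEQ_power_zero) simp
  then have "(\<lambda>n. z (Suc n) - c) \<longlonglongrightarrow> 0"
    by (rule Lim_null_comparison[rotated]) (use geo in simp)
  then have lim1: "(\<lambda>n. z (Suc n)) \<longlonglongrightarrow> c" by (rule LIM_zero_cancel)
  then have lim: "z \<longlonglongrightarrow> c" by (rule LIMSEQ_imp_Suc)
  have "(\<lambda>j. \<bar>z (Suc j) - c\<bar> / \<bar>z j - c\<bar>) \<longlonglongrightarrow> 0" if nz: "\<And>j. z j \<noteq> c"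
  proof -
    \<comment> \<open>The ratio is bounded for the shifted sequence, because a secant step involves
      two earlier errors.\<close>
    have "norm (\<bar>z (Suc (Suc n)) - c\<bar> / \<bar>z (Suc n) - c\<bar>)
        \<le> 2 * L / \<bar>a\<bar> * (2 * \<bar>z (Suc n) - c\<bar> + \<bar>z n - c\<bar>)" for n
    proof -
      have "\<bar>z (Suc (Suc n)) - c\<bar>
          \<le> \<bar>z (Suc n) - c\<bar> * (2 * L / \<bar>a\<bar> * (2 * \<bar>z (Suc n) - c\<bar> + \<bar>z n - c\<bar>))"
        unfolding step[OF nz] using inv[of n] nz by (intro secant(2)) auto
      then show ?thesis
        using nz[of "Suc n"] by (simp add: pos_divide_le_eq mult.commute)
    qed
    note bound = this
    have "(\<lambda>n. 2 * L / \<bar>a\<bar> * (2 * \<bar>z (Suc n) - c\<bar> + \<bar>z n - c\<bar>)) \<longlonglongrightarrow>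
        2 * L / \<bar>a\<bar> * (2 * \<bar>c - c\<bar> + \<bar>c - c\<bar>)"
      by (intro tendsto_intros lim lim1)
    also have "2 * L / \<bar>a\<bar> * (2 * \<bar>c - c\<bar> + \<bar>c - c\<bar>) = 0" by simp
    finally have "(\<lambda>n. \<bar>z (Suc (Suc n)) - c\<bar> / \<bar>z (Suc n) - c\<bar>) \<longlonglongrightarrow> 0"
      by (rule Lim_null_comparison[OF always_eventually[OF allI[OF bound]]])
    then show ?thesis by (rule LIMSEQ_imp_Suc)
  qed
  with lim show "converges_superlinearly z c"
    by (simp add: converges_superlinearly_def)
qed

text \<open>Convergence is proved for the tail that begins with the given pair of iterates; this
  carries it back to the whole run.\<close>

lemma converges_superlinearly_offset:
  assumes "converges_superlinearly (\<lambda>n. x (n + m)) c"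
  shows "converges_superlinearly x c"
proof -
  have "x \<longlonglongrightarrow> c"
    using assms LIMSEQ_offset[of x m c] unfolding converges_superlinearly_def by blast
  moreover have "(\<lambda>j. \<bar>x (Suc j) - c\<bar> / \<bar>x j - c\<bar>) \<longlonglongrightarrow> 0" if "\<forall>j. x j \<noteq> c"
    by (rule LIMSEQ_offset[of _ m])
      (use assms that in \<open>simp add: converges_superlinearly_def\<close>)
  ultimately show ?thesis
    unfolding converges_superlinearly_def by blast
qed

section \<open>Estimates on a neighbourhood of the root\<close>

text \<open>Every condition defining \<open>N1\<close> is open and holds at \<open>c\<close>, where
  the error is 0, provided that \<open>M0\<close> and \<open>M1\<close> are nonnegative.\<close>

lemma eventually_in_N1:
  assumes "p > 0" "open N" "c \<in> N"
    and "bounded ((\<lambda>x. deriv g x / g x) ` N)"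
    and "bounded ((\<lambda>x. deriv (deriv g) x / g x) ` N)"
  shows "\<forall>\<^sub>F x in nhds c. x \<in> N1 c p g N"
proof -
  obtain B where B: "\<And>x. x \<in> N \<Longrightarrow> \<bar>deriv g x / g x\<bar> \<le> B"
    using assms(4) by (auto simp: bounded_iff)
  obtain C where C: "\<And>x. x \<in> N \<Longrightarrow> \<bar>deriv (deriv g) x / g x\<bar> \<le> C"
    using assms(5) by (auto simp: bounded_iff)
  \<comment> \<open>A real supremum is informative only for a set bounded above, so boundedness is
    established before comparing with the value at \<open>c\<close>.\<close>
  have "M1 p g N \<ge> 0"
  proof -
    have "1 / p * \<bar>deriv g x / g x\<bar> \<le> 1 / p * B" if "x \<in> N" for x
      using B[OF that] \<open>p > 0\<close> by (intro mult_left_mono) auto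
    then have "bdd_above ((\<lambda>x. 1 / p * \<bar>deriv g x / g x\<bar>) ` N)" by (rule bdd_aboveI2)
    from cSUP_upper[OF \<open>c \<in> N\<close> this] \<open>p > 0\<close> show ?thesis
      unfolding M1_def by (smt (verit) divide_nonneg_pos mult_nonneg_nonneg)
  qed
  moreover have "M0 p g N \<ge> 0"
  proof -
    have "1 / p * \<bar>(deriv g x / g x)\<^sup>2 - deriv (deriv g) x / g x\<bar> \<le> 1 / p * (B\<^sup>2 + C)"
      if "x \<in> N" for x
    proof -
      have "(deriv g x / g x)\<^sup>2 \<le> B\<^sup>2"
        using B[OF that] by (metis abs_ge_zero power2_abs power_mono)
      then have "\<bar>(deriv g x / g x)\<^sup>2 - deriv (deriv g) x / g x\<bar> \<le> B\<^sup>2 + C"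
        using C[OF that] zero_le_power2[of "deriv g x / g x"] by linarith
      then show ?thesis using \<open>p > 0\<close> by (intro mult_left_mono) auto
    qed
    then have "bdd_above ((\<lambda>x. 1 / p * \<bar>(deriv g x / g x)\<^sup>2 - deriv (deriv g) x / g x\<bar>) ` N)"
      by (rule bdd_aboveI2)
    from cSUP_upper[OF \<open>c \<in> N\<close> this] \<open>p > 0\<close> show ?thesis
      unfolding M0_def by (smt (verit) divide_nonneg_pos mult_nonneg_nonneg)
  qed
  \<comment> \<open>The parameter \<open>r\<close> covers two conditions on \<open>M1\<close>: 1 for
    the one in \<open>N0\<close> and 1/2 for the one in \<open>N1\<close>.\<close>
  moreover have "\<forall>\<^sub>F x in nhds c. M = 0 \<or> \<bar>c - x\<bar> < r / M" if "M \<ge> 0" "r > 0" for M r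
  proof (cases "M = 0")
    case False
    have "((\<lambda>x. \<bar>c - x\<bar>) \<longlongrightarrow> \<bar>c - c\<bar>) (nhds c)"
      by (intro tendsto_intros filterlim_ident)
    from order_tendstoD(2)[OF this, of "r / M"] show ?thesis using that False by simp
  qed simp
  moreover have "\<forall>\<^sub>F x in nhds c. M = 0 \<or> (c - x)\<^sup>2 < 1 / M" if "M \<ge> 0" for M
  proof (cases "M = 0")
    case False
    have "((\<lambda>x. (c - x)\<^sup>2) \<longlongrightarrow> (c - c)\<^sup>2) (nhds c)"
      by (intro tendsto_intros filterlim_ident)
    from order_tendstoD(2)[OF this, of "1 / M"] show ?thesis using that False by simp
  qed simp
  moreover have "\<forall>\<^sub>F x in nhds c. x \<in> N"
    using assms(2,3) by (rule eventually_nhds_in_open)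
  moreover have "1 / (2 * M1 p g N) = (1 / 2) / M1 p g N" by simp
  ultimately show ?thesis
    unfolding N1_def N0_def mem_Collect_eq by (simp only: eventually_conj_iff)
qed

text \<open>With \<open>h = g' / g\<close> and \<open>q = p + (x - c) * h x\<close>, the update is
  \<open>(x - c) * (- 1 / q x)\<close>. The bounds on \<open>g' / g\<close> and
  \<open>g'' / g\<close> make \<open>q\<close> Lipschitz and keep it away from 0 near
  \<open>c\<close>, so the second factor is Lipschitz with value \<open>- 1 / p\<close> at
  \<open>c\<close>.\<close>

lemma newton_update_near_root:
  assumes "p > 0" "real_power p pw" "\<And>x. f x = pw (x - c) * g x" "C2 g"
    and N: "open N" "c \<in> N" "\<And>x. x \<in> N \<Longrightarrow> g x \<noteq> 0"
    and "bounded ((\<lambda>x. deriv g x / g x) ` N)"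
    and "bounded ((\<lambda>x. deriv (deriv g) x / g x) ` N)"
  obtains e L where "e > 0" "L \<ge> 0"
    "\<And>x. x \<in> ball c e \<Longrightarrow> x \<noteq> c \<Longrightarrow> deriv f x \<noteq> 0"
    "\<And>x y. x \<in> ball c e \<Longrightarrow> y \<in> ball c e \<Longrightarrow>
      \<bar>newton_update f x - newton_update f y - - 1 / p * (x - y)\<bar>
        \<le> L * (\<bar>x - c\<bar> + \<bar>y - c\<bar>) * \<bar>x - y\<bar>"
proof -
  obtain B where B: "\<And>x. x \<in> N \<Longrightarrow> \<bar>deriv g x / g x\<bar> \<le> B"
    using assms(8) by (auto simp: bounded_iff)
  obtain C where C: "\<And>x. x \<in> N \<Longrightarrow> \<bar>deriv (deriv g) x / g x\<bar> \<le> C"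
    using assms(9) by (auto simp: bounded_iff)
  have BC: "B \<ge> 0" "C \<ge> 0" using B[OF N(2)] C[OF N(2)] by linarith+
  define h where "h = (\<lambda>x. deriv g x / g x)"
  define q where "q = (\<lambda>x. p + (x - c) * h x)"
  \<comment> \<open>Bounds \<open>q' = h + (t - c) * h'\<close> for \<open>t\<close> within distance
    1 of \<open>c\<close>, where \<open>h' = g'' / g - h^2\<close>; up to sign and the factor
    \<open>1 / p\<close>, this \<open>h'\<close> is the quantity in \<open>M0\<close>.\<close>
  define Q where "Q = B + (C + B\<^sup>2)"
  have g': "(g has_real_derivative deriv g x) (at x)"
    and g'': "(deriv g has_real_derivative deriv (deriv g) x) (at x)" for x
    using \<open>C2 g\<close> by (simp_all add: C2_def DERIV_deriv_iff_real_differentiable)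
  obtain e0 where e0: "e0 > 0" "ball c e0 \<subseteq> N"
    using N by (meson openE)
  \<comment> \<open>The three radii keep the ball inside \<open>N\<close>, justify \<open>Q\<close>,
    and give \<open>q \<ge> p / 2\<close>. Using \<open>B + 1\<close> keeps the divisor positive
    when \<open>B\<close> is 0.\<close>
  define e where "e = min e0 (min 1 (p / (2 * (B + 1))))"
  have "e > 0" using e0(1) \<open>p > 0\<close> BC by (simp add: e_def)
  have in_N: "x \<in> N" and near: "\<bar>x - c\<bar> \<le> 1" and q_lower: "p / 2 \<le> q x"
    if "x \<in> ball c e" for x
  proof -
    have x: "\<bar>x - c\<bar> < e0" "\<bar>x - c\<bar> \<le> 1" "\<bar>x - c\<bar> \<le> p / (2 * (B + 1))"
      using that by (auto simp: e_def dist_real_def)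
    show "x \<in> N" using x(1) e0(2) by (auto simp: dist_real_def)
    show "\<bar>x - c\<bar> \<le> 1" by (rule x)
    have "\<bar>(x - c) * h x\<bar> \<le> p / (2 * (B + 1)) * (B + 1)"
      unfolding abs_mult using x(3) B[OF \<open>x \<in> N\<close>] BC \<open>p > 0\<close>
      by (intro mult_mono) (auto simp: h_def)
    also have "\<dots> = p / 2" using BC by (simp add: field_simps)
    finally show "p / 2 \<le> q x" unfolding q_def by linarith
  qed
  have q_lip: "\<bar>q x - q y\<bar> \<le> Q * \<bar>x - y\<bar>" if xy: "x \<in> ball c e" "y \<in> ball c e" for x y
  proof -
    have "norm (q x - q y) \<le> Q * norm (x - y)"
    proof (rule field_differentiable_bound[OF convex_ball _ _ xy])
      fix t assume t: "t \<in> ball c e"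
      note tN = in_N[OF t]
      have "(h has_real_derivative deriv (deriv g) t / g t - (h t)\<^sup>2) (at t)"
        unfolding h_def by (rule DERIV_cong[OF DERIV_divide[OF g'' g' N(3)[OF tN]]])
          (use N(3)[OF tN] in \<open>simp add: field_simps power2_eq_square\<close>)
      then have "(q has_real_derivative h t + (t - c) * (deriv (deriv g) t / g t - (h t)\<^sup>2)) (at t)"
        unfolding q_def by (auto intro!: derivative_eq_intros)
      then show "(q has_field_derivative h t + (t - c) * (deriv (deriv g) t / g t - (h t)\<^sup>2))
          (at t within ball c e)"
        by (rule has_field_derivative_at_within)
      have "(h t)\<^sup>2 \<le> B\<^sup>2"
        using B[OF tN] unfolding h_def by (metis abs_ge_zero power2_abs power_mono)
      then have "\<bar>deriv (deriv g) t / g t - (h t)\<^sup>2\<bar> \<le> C + B\<^sup>2"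
        using C[OF tN] zero_le_power2[of "h t"] by linarith
      then have "\<bar>t - c\<bar> * \<bar>deriv (deriv g) t / g t - (h t)\<^sup>2\<bar> \<le> 1 * (C + B\<^sup>2)"
        using near[OF t] by (intro mult_mono) auto
      then show "norm (h t + (t - c) * (deriv (deriv g) t / g t - (h t)\<^sup>2)) \<le> Q"
        using B[OF tN] abs_triangle_ineq[of "h t" "(t - c) * (deriv (deriv g) t / g t - (h t)\<^sup>2)"]
        by (simp add: Q_def h_def abs_mult)
    qed
    then show ?thesis by simp
  qed
  have c: "c \<in> ball c e" using \<open>e > 0\<close> by simp
  have update: "newton_update f x = (x - c) * (- 1 / q x)" "x \<noteq> c \<Longrightarrow> deriv f x \<noteq> 0"
    if "x \<in> ball c e" for x
  proof -
    have "g differentiable (at x)" using \<open>C2 g\<close> by (simp add: C2_def)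
    moreover have "p + (x - c) * (deriv g x / g x) \<noteq> 0"
      using q_lower[OF that] \<open>p > 0\<close> unfolding q_def h_def by linarith
    ultimately show "newton_update f x = (x - c) * (- 1 / q x)" "x \<noteq> c \<Longrightarrow> deriv f x \<noteq> 0"
      using newton_update_multiple_root[OF assms(2,3)] N(3)[OF in_N[OF that]]
      unfolding q_def h_def by blast+
  qed
  show ?thesis
  proof (rule that[OF \<open>e > 0\<close>])
    show "0 \<le> Q / (p / 2)\<^sup>2" using BC by (simp add: Q_def)
    show "deriv f x \<noteq> 0" if "x \<in> ball c e" "x \<noteq> c" for x
      using that by (rule update(2))
    fix x y assume xy: "x \<in> ball c e" "y \<in> ball c e"
    have k_lip: "\<bar>- 1 / q x - (- 1 / q y)\<bar> \<le> Q / (p / 2)\<^sup>2 * \<bar>x - y\<bar>"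
      if "x \<in> ball c e" "y \<in> ball c e" for x y
      by (rule reciprocal_lipschitz[where S = "ball c e"])
        (use q_lip q_lower \<open>p > 0\<close> that in \<open>blast intro: half_gt_zero\<close>)+
    have "- 1 / q c = - 1 / p" by (simp add: q_def)
    then show "\<bar>newton_update f x - newton_update f y - - 1 / p * (x - y)\<bar>
        \<le> Q / (p / 2)\<^sup>2 * (\<bar>x - c\<bar> + \<bar>y - c\<bar>) * \<bar>x - y\<bar>"
      unfolding update(1)[OF xy(1)] update(1)[OF xy(2)]
      using linear_factor_times_lipschitz[where k = "\<lambda>x. - 1 / q x", OF k_lip c xy] by metis
  qed
qed

section \<open>Choice of the interval and passage to the tail of the run\<close>

theorem theorem2:
  fixes c p :: real and f g pw :: "real \<Rightarrow> real" and N :: "real set"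
  assumes "p > 1"
    and "real_power p pw"
    and "\<And>x. f x = pw (x - c) * g x"
    and "C2 g"
    and "open_interval N" and "c \<in> N"
    and "\<And>x. x \<in> N \<Longrightarrow> g x \<noteq> 0"
    and "bounded ((\<lambda>x. deriv g x / g x) ` N)"
    and "bounded ((\<lambda>x. deriv (deriv g) x / g x) ` N)"
  shows "\<exists>Ns. open_interval Ns \<and> c \<in> Ns \<and> Ns \<subseteq> N1 c p g N \<and>
           (\<forall>x k. newton_anderson f c x \<and> k \<ge> 1 \<and>
              x (k - 1) \<in> Ns \<and> x k \<in> Ns \<and>
              x (k - 1) \<noteq> x k \<and> x (k - 1) \<noteq> c \<and> x k \<noteq> c \<longrightarrow>
              (\<forall>j\<ge>k. x j \<in> Ns \<and> (x j \<noteq> c \<longrightarrow> update_defined f x j)) \<and>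
              converges_superlinearly x c)"
proof -
  note N = \<open>open_interval N\<close>[unfolded open_interval_def, THEN conjunct1]
  have "p > 0" using \<open>p > 1\<close> by simp
  obtain e L where e: "e > 0" and L: "L \<ge> 0"
    and f': "\<And>x. x \<in> ball c e \<Longrightarrow> x \<noteq> c \<Longrightarrow> deriv f x \<noteq> 0"
    and w: "\<And>x y. x \<in> ball c e \<Longrightarrow> y \<in> ball c e \<Longrightarrow>
      \<bar>newton_update f x - newton_update f y - - 1 / p * (x - y)\<bar>
        \<le> L * (\<bar>x - c\<bar> + \<bar>y - c\<bar>) * \<bar>x - y\<bar>"
    using newton_update_near_root[OF \<open>p > 0\<close> assms(2-4) N assms(6-9)] by blast
  obtain r where r: "r > 0" "\<And>x. dist x c < r \<Longrightarrow> x \<in> N1 c p g N"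
    using eventually_in_N1[OF \<open>p > 0\<close> N assms(6,8,9)] by (auto simp: eventually_nhds_metric)
  \<comment> \<open>The last radius gives \<open>12 * L * d \<le> 1 / p\<close>, the smallness
    condition of the secant lemmas for slope \<open>- 1 / p\<close>; \<open>L + 1\<close> guards
    against \<open>L\<close> being 0.\<close>
  define d where "d = min (min e r) (1 / (12 * p * (L + 1)))"
  have d: "d > 0" "d \<le> e" "d \<le> r"
    using e r(1) \<open>p > 0\<close> L by (auto simp: d_def)
  have "12 * L * d \<le> 12 * (L + 1) * (1 / (12 * p * (L + 1)))"
    using L d(1) by (intro mult_mono) (auto simp: d_def)
  also have "\<dots> = \<bar>- 1 / p\<bar>"
  proof -
    have "12 * l * (1 / (12 * p * l)) = \<bar>- 1 / p\<bar>" if "l > 0" for l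
      using that \<open>p > 0\<close> by simp
    from this[of "L + 1"] L show ?thesis by linarith
  qed
  finally have dL: "12 * L * d \<le> \<bar>- 1 / p\<bar>" .
  have sub: "ball c d \<subseteq> ball c e" using d(2) by (rule subset_ball)
  have wc: "newton_update f c = 0"
    using real_power_0[OF assms(2)] by (simp add: newton_update_def assms(3))
  show ?thesis
  proof (intro exI[of _ "ball c d"] conjI allI impI)
    show "open_interval (ball c d)" by (simp add: open_interval_def is_interval_ball_real)
    show "c \<in> ball c d" using d(1) by simp
    show "ball c d \<subseteq> N1 c p g N" using r(2) d(3) by (auto simp: dist_commute)
    fix x :: "nat \<Rightarrow> real" and k :: nat
    assume A: "newton_anderson f c x \<and> k \<ge> 1 \<and> x (k - 1) \<in> ball c d \<and> x k \<in> ball c d \<and>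
      x (k - 1) \<noteq> x k \<and> x (k - 1) \<noteq> c \<and> x k \<noteq> c"
    then obtain m where k: "k = Suc m" by (cases k) auto
    \<comment> \<open>Since \<open>k = Suc m\<close>, the tail starts one index early:
      \<open>z 0\<close> is \<open>x (k - 1)\<close> and \<open>z 1\<close> is
      \<open>x k\<close>.\<close>
    define z where "z = (\<lambda>n. x (n + m))"
    have stop: "\<And>n. x n = c \<Longrightarrow> x (Suc n) = c"
      using A by (simp add: newton_anderson_def)
    have run: "z 0 \<in> ball c d" "z 1 \<in> ball c d" "z 0 \<noteq> z 1"
      "\<And>n. z n = c \<Longrightarrow> z (Suc n) = c"
      "\<And>n. z (Suc n) \<noteq> c \<Longrightarrow> z (Suc (Suc n)) = z (Suc n) -
        (z (Suc n) - z n) / (newton_update f (z (Suc n)) - newton_update f (z n))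
          * newton_update f (z (Suc n))"
      using A by (simp_all add: z_def k newton_anderson_def)
    have z_in: "z n \<in> ball c d"
      and w_ne: "z (Suc n) \<noteq> c \<Longrightarrow> newton_update f (z (Suc n)) \<noteq> newton_update f (z n)"
      and z_conv: "converges_superlinearly z c" for n
      by (rule secant_converges[of c d "newton_update f" "- 1 / p" L z,
          OF w[OF subsetD[OF sub] subsetD[OF sub]] wc _ L dL run];
        use \<open>p > 0\<close> in simp)+
    show "converges_superlinearly x c"
      by (rule converges_superlinearly_offset[of x m]) (use z_conv in \<open>simp add: z_def\<close>)
    fix j assume "k \<le> j"
    then obtain n where j: "j = Suc n + m" by (auto simp: k le_iff_add add.commute)
    show "x j \<in> ball c d" using z_in[of "Suc n"] by (simp add: z_def j)
    assume "x j \<noteq> c"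
    \<comment> \<open>The stopping rule read backwards: if \<open>x j\<close> is not the root,
      neither is its predecessor, so \<open>f'\<close> is nonzero at both points.\<close>
    then have ne: "z (Suc n) \<noteq> c" "z n \<noteq> c" using stop by (auto simp: z_def j)
    then have "deriv f (z (Suc n)) \<noteq> 0" "deriv f (z n) \<noteq> 0"
      using f'[OF subsetD[OF sub z_in]] by simp_all
    moreover have "newton_update f (z (Suc n)) \<noteq> newton_update f (z n)"
      by (rule w_ne[OF ne(1)])
    ultimately show "update_defined f x j"
      by (simp add: update_defined_def z_def j)
  qed
qed

end
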